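(* Let $a,b,c,d,q\in\mathbb{C}$ be generic with $|q|<1$ and let $m\in\mathbb{Z}_{\ge0}$. Then, as an identity of formal Laurent series in $x$, $${}_4\phi_3\left[{q^{-m},abcdq^{m-1},ax,a/x\atop ab,ac,ad};q,q\right]=a^mx^{-m}\frac{(abcdq^{m-1};q)_m}{(ab,ac,ad;q)_m}\Psi(x;q^{-m}|a,b,c,d|q),$$ where $$\Psi(x;s|a,b,c,d|q)=\frac{(ax;q)_\infty}{(qx/a;q)_\infty}\sum_{n\ge0}\frac{(qs^2/a^2;q)_n}{(q;q)_n}\Big(\frac{ax}{s}\Big)^n{}_6\phi_5\left[{q^{-n},q^{n+1}s^2/a^2,s,qs/ab,qs/ac,qs/ad\atop q^2s^2/abcd,q^{1/2}s/a,-q^{1/2}s/a,qs/a,-qs/a};q,q\right]$$ and $(ax;q)_\infty/(qx/a;q)_\infty$ is expanded as a power series in $x$.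
   Context: Notation: $(a_1,\dots,a_k;q)_n=\prod_{j=1}^k\prod_{i=0}^{n-1}(1-q^ia_j)$ (also for $n=\infty$) and ${}_{r+1}\phi_r\left[{a_1,\dots,a_{r+1}\atop b_1,\dots,b_r};q,z\right]=\sum_{m\ge0}\frac{(a_1,\dots,a_{r+1};q)_m}{(q,b_1,\dots,b_r;q)_m}z^m$. *)

theory Defs
  imports "HOL-Complex_Analysis.Complex_Analysis"
begin

definition qpoch :: "'a::comm_ring_1 list \<Rightarrow> 'a \<Rightarrow> nat \<Rightarrow> 'a" where
  "qpoch as q n = (\<Prod>a\<leftarrow>as. \<Prod>i<n. 1 - q ^ i * a)"

definition qpoch_inf :: "complex list \<Rightarrow> complex \<Rightarrow> complex" where
  "qpoch_inf as q = (\<Prod>a\<leftarrow>as. \<Prod>i. 1 - q ^ i * a)"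

text \<open>
  The basic hypergeometric series, with upper parameters \<open>as\<close> and lower parameters \<open>bs\<close>, where
  \<open>length as = length bs + 1\<close>. It is used both for complex numbers and for formal Laurent series;
  the series considered below all terminate, so the topology plays no role.
\<close>
definition basic_hypergeo ::
    "'a::{field,topological_space} list \<Rightarrow> 'a list \<Rightarrow> 'a \<Rightarrow> 'a \<Rightarrow> 'a" where
  "basic_hypergeo as bs q z = (\<Sum>k. qpoch as q k / qpoch (q # bs) q k * z ^ k)"

text \<open>
  The formal power series in \<open>x\<close> called \<open>\<Psi>(x; s | a, b, c, d | q)\<close>. The infinite products are
  expanded as the Taylor series at \<open>0\<close> of the quotient, which is analytic near \<open>x = 0\<close>. The two
  square roots of \<open>q\<close> enter symmetrically, so the choice of branch for \<open>q\<^sup>1\<^sup>/\<^sup>2\<close> is immaterial.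
\<close>
definition Psi ::
    "complex \<Rightarrow> complex \<Rightarrow> complex \<Rightarrow> complex \<Rightarrow> complex \<Rightarrow> complex \<Rightarrow> complex fps" where
  "Psi s a b c d q =
     fps_expansion (\<lambda>x. qpoch_inf [a * x] q / qpoch_inf [q * x / a] q) 0 *
     Abs_fps (\<lambda>n. qpoch [q * s^2 / a^2] q n / qpoch [q] q n * (a / s) ^ n *
       basic_hypergeo
         [q powi (- int n), q ^ (n + 1) * s^2 / a^2, s, q * s / (a * b), q * s / (a * c), q * s / (a * d)]
         [q^2 * s^2 / (a * b * c * d), csqrt q * s / a, - (csqrt q * s / a), q * s / a, - (q * s / a)]
         q q)"

text \<open>
  Genericity of the parameters: for \<open>0 < \<bar>q\<bar> < 1\<close> and \<open>s = q\<^sup>-\<^sup>m\<close>, these are exactly the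
  conditions under which, for every \<open>m\<close>, no denominator vanishes in any term that occurs before
  the terminating series below break off. The condition on \<open>a^2\<close> takes care of the last four
  lower parameters of the series in \<open>Psi\<close>.
\<close>
definition generic_params ::
    "complex \<Rightarrow> complex \<Rightarrow> complex \<Rightarrow> complex \<Rightarrow> complex \<Rightarrow> bool" where
  "generic_params a b c d q \<longleftrightarrow>
     a \<noteq> 0 \<and> b \<noteq> 0 \<and> c \<noteq> 0 \<and> d \<noteq> 0 \<and> q \<noteq> 0 \<and>
     (\<forall>k::nat. q ^ k * (a * b) \<noteq> 1 \<and> q ^ k * (a * c) \<noteq> 1 \<and> q ^ k * (a * d) \<noteq> 1 \<and>
        q ^ k * (a * b * c * d) \<noteq> 1 \<and> q ^ k * a^2 \<noteq> 1)"

end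

theory Submission
  imports Defs
begin

text \<open>
  Exchanging the two summations in \<open>\<Psi>\<close>, the sum over \<open>n\<close> at a fixed index \<open>k\<close> of the
  inner series is, by the \<open>q\<close>-binomial theorem,
  \<open>(q\<^sup>1\<^sup>+\<^sup>k s x / a; q)\<^sub>\<infinity> / (a x q\<^sup>-\<^sup>k / s; q)\<^sub>\<infinity>\<close> up to a monomial in \<open>x\<close>. For \<open>s = q\<^sup>-\<^sup>m\<close>
  its product with \<open>(a x; q)\<^sub>\<infinity> / (q x / a; q)\<^sub>\<infinity>\<close> collapses to a polynomial, which is a
  multiple of \<open>x\<^sup>j (a x, a / x; q)\<^sub>j\<close> with \<open>j = m - k\<close>. So the right-hand side is a finite
  sum over \<open>k\<close>, and it equals the left-hand side term by term after reversing the
  order of summation.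
\<close>

subsection \<open>Infinite products as formal power series\<close>

lemma qpoch_Nil [simp]: "qpoch [] q n = 1"
  by (simp add: qpoch_def)

lemma qpoch_Cons: "qpoch (a # as) q n = (\<Prod>i<n. 1 - q ^ i * a) * qpoch as q n"
  by (simp add: qpoch_def)

section \<open>Convergence and analyticity of the infinite product\<close>

lemma convergent_prod_qpoch_inf:
  fixes q x :: complex
  assumes "norm q < 1"
  shows "convergent_prod (\<lambda>i. 1 - q ^ i * x)"
proof (rule abs_convergent_prod_imp_convergent_prod, rule summable_imp_abs_convergent_prod)
  show "summable (\<lambda>i. norm (1 - q ^ i * x - 1))"
    using assms by (auto simp: norm_mult norm_power intro!: summable_mult2 summable_geometric)
qed

lemma LIMSEQ_qpoch_inf:
  assumes "norm q < 1"
  shows "(\<lambda>n. \<Prod>i<n. 1 - q ^ i * x) \<longlonglongrightarrow> qpoch_inf [x] q"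
  using convergent_prod_LIMSEQ[OF convergent_prod_qpoch_inf[OF assms, of x]]
  by (simp add: qpoch_inf_def LIMSEQ_lessThan_iff_atMost)

lemma qpoch_inf_rec:
  assumes "norm q < 1"
  shows "qpoch_inf [x] q = (1 - x) * qpoch_inf [q * x] q"
proof (rule LIMSEQ_unique)
  show "(\<lambda>n. \<Prod>i<Suc n. 1 - q ^ i * x) \<longlonglongrightarrow> qpoch_inf [x] q"
    using LIMSEQ_qpoch_inf[OF assms] by (rule LIMSEQ_Suc)
  have "(\<Prod>i<Suc n. 1 - q ^ i * x) = (1 - x) * (\<Prod>i<n. 1 - q ^ i * (q * x))" for n
    by (subst prod.lessThan_Suc_shift) (simp add: algebra_simps)
  then show "(\<lambda>n. \<Prod>i<Suc n. 1 - q ^ i * x) \<longlonglongrightarrow> (1 - x) * qpoch_inf [q * x] q"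
    using tendsto_mult_left[OF LIMSEQ_qpoch_inf[OF assms, of "q * x"]] by simp
qed

lemma qpoch_inf_0 [simp]: "qpoch_inf [0] q = 1"
  by (simp add: qpoch_inf_def)

text \<open>The partial products are polynomials in \<open>x\<close>, and the M-test with majorant
  \<open>norm q ^ n * (norm z + 1)\<close> makes them converge uniformly on the closed unit disc
  about any \<open>z\<close>.\<close>

lemma holomorphic_qpoch_inf:
  assumes "norm q < 1"
  shows "(\<lambda>x. qpoch_inf [x] q) holomorphic_on UNIV"
proof (rule holomorphic_uniform_sequence)
  fix z :: complex
  let ?P = "\<lambda>n x. \<Prod>i<n. 1 - q ^ i * x"
  have "uniformly_convergent_on (cball z 1) ?P"
  proof (rule uniformly_convergent_on_prod')
    show "uniformly_convergent_on (cball z 1) (\<lambda>N x. \<Sum>n<N. norm (1 - q ^ n * x - 1))"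
    proof (rule Weierstrass_m_test'_ev, intro always_eventually allI ballI)
      fix n x assume "x \<in> cball z 1"
      then have "norm x \<le> norm z + 1"
        using norm_triangle_ineq2[of x z] by (simp add: dist_norm norm_minus_commute)
      then show "norm (norm (1 - q ^ n * x - 1)) \<le> norm q ^ n * (norm z + 1)"
        by (simp add: norm_mult norm_power mult_left_mono)
    qed (use assms in \<open>auto intro!: summable_mult2 summable_geometric\<close>)
  qed (auto intro!: continuous_intros)
  then obtain g where g: "uniform_limit (cball z 1) ?P g sequentially"
    by (auto simp: uniformly_convergent_on_def)
  \<comment> \<open>The M-test only yields some limit function \<open>g\<close>; uniqueness of
    pointwise limits identifies it.\<close>
  have "g x = qpoch_inf [x] q" if "x \<in> cball z 1" for x
    using tendsto_uniform_limitI[OF g that] LIMSEQ_qpoch_inf[OF assms] LIMSEQ_unique by blast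
  then have "uniform_limit (cball z 1) ?P (\<lambda>x. qpoch_inf [x] q) sequentially"
    using g uniform_limit_cong'[of "cball z 1" ?P ?P g] by fastforce
  then show "\<exists>d>0. cball z d \<subseteq> UNIV \<and> uniform_limit (cball z d) ?P (\<lambda>x. qpoch_inf [x] q) sequentially"
    by (intro exI[of _ 1]) auto
qed (auto intro!: holomorphic_intros)

lemma analytic_qpoch_inf:
  assumes "norm q < 1"
  shows "(\<lambda>x. qpoch_inf [u * x] q) analytic_on A"
proof -
  have "(\<lambda>x. qpoch_inf [x] q) \<circ> (\<lambda>x. u * x) holomorphic_on UNIV"
    by (rule holomorphic_on_compose_gen[OF _ holomorphic_qpoch_inf[OF assms]])
       (auto intro!: holomorphic_intros)
  then show ?thesis
    unfolding o_def by (metis analytic_on_holomorphic open_UNIV subset_UNIV)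
qed

text \<open>Keeping \<open>u\<close> as a parameter turns the substitution of \<open>v x\<close> for
  \<open>x\<close> into multiplication of \<open>u\<close> by \<open>v\<close>, which is how the
  \<open>q\<close>-difference equation below is expressed.\<close>

definition qpoch_inf_fps :: "complex \<Rightarrow> complex \<Rightarrow> complex fps" where
  "qpoch_inf_fps q u = fps_expansion (\<lambda>x. qpoch_inf [u * x] q) 0"

context
  fixes q :: complex
  assumes q: "norm q < 1"
begin

lemma has_fps_expansion_qpoch_inf:
  "(\<lambda>x. qpoch_inf [u * x] q) has_fps_expansion qpoch_inf_fps q u"
  unfolding qpoch_inf_fps_def
  by (rule analytic_at_imp_has_fps_expansion_0[OF analytic_qpoch_inf[OF q]])

lemma qpoch_inf_fps_nth_0 [simp]: "fps_nth (qpoch_inf_fps q u) 0 = 1"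
  using has_fps_expansion_imp_0_eq_fps_nth_0[OF has_fps_expansion_qpoch_inf, of u] by simp

lemma qpoch_inf_fps_rec:
  "qpoch_inf_fps q u = (1 - fps_const u * fps_X) * qpoch_inf_fps q (q * u)"
proof (rule fps_expansion_unique_complex[OF has_fps_expansion_qpoch_inf])
  have "(\<lambda>x. qpoch_inf [u * x] q) = (\<lambda>x. (1 - u * x) * qpoch_inf [(q * u) * x] q)"
    using qpoch_inf_rec[OF q, of "u * x" for x] by (simp add: fun_eq_iff mult.assoc)
  then show "(\<lambda>x. qpoch_inf [u * x] q) has_fps_expansion
      (1 - fps_const u * fps_X) * qpoch_inf_fps q (q * u)"
    by (simp only:) (intro fps_expansion_intros has_fps_expansion_qpoch_inf)
qed

lemma qpoch_inf_fps_compose: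
  "qpoch_inf_fps q u oo (fps_const v * fps_X) = qpoch_inf_fps q (v * u)"
proof (rule fps_expansion_unique_complex[OF _ has_fps_expansion_qpoch_inf])
  have "((\<lambda>x. qpoch_inf [u * x] q) \<circ> (\<lambda>x. v * x)) has_fps_expansion
      (qpoch_inf_fps q u oo (fps_const v * fps_X))"
    by (intro fps_expansion_intros has_fps_expansion_qpoch_inf) auto
  then show "(\<lambda>x. qpoch_inf [v * u * x] q) has_fps_expansion
      (qpoch_inf_fps q u oo (fps_const v * fps_X))"
    by (simp add: o_def mult_ac)
qed

lemma qpoch_inf_fps_split:
  "qpoch_inf_fps q u = (\<Prod>i<n. 1 - fps_const (q ^ i * u) * fps_X) * qpoch_inf_fps q (q ^ n * u)"
proof (induction n)
  case (Suc n)
  show ?case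
    by (subst Suc, subst qpoch_inf_fps_rec) (simp add: mult_ac)
qed simp

text \<open>The denominator is 1 at \<open>x = 0\<close>, so it is nonzero nearby and the quotient
  is analytic there. The multiplied-out form avoids inverting a power series and is what the
  cancellation in \<open>Psi_eq\<close> uses.\<close>

lemma fps_expansion_qpoch_inf_quotient:
  "fps_expansion (\<lambda>x. qpoch_inf [u * x] q / qpoch_inf [v * x] q) 0 * qpoch_inf_fps q v =
     qpoch_inf_fps q u"
proof (rule fps_expansion_unique_complex[OF _ has_fps_expansion_qpoch_inf])
  let ?f = "\<lambda>x. qpoch_inf [u * x] q / qpoch_inf [v * x] q"
  have "?f has_fps_expansion fps_expansion ?f 0"
    by (rule analytic_at_imp_has_fps_expansion_0, rule analytic_on_divide)
       (auto intro: analytic_qpoch_inf[OF q])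
  then have "(\<lambda>x. ?f x * qpoch_inf [v * x] q) has_fps_expansion
      fps_expansion ?f 0 * qpoch_inf_fps q v"
    by (intro fps_expansion_intros has_fps_expansion_qpoch_inf)
  moreover have "isCont (\<lambda>x. qpoch_inf [v * x] q) 0"
    using analytic_qpoch_inf[OF q, of v "{0}"] by (rule analytic_at_imp_isCont)
  then have "\<forall>\<^sub>F x in nhds 0. qpoch_inf [v * x] q \<noteq> 0"
    using tendsto_imp_eventually_ne[of "\<lambda>x. qpoch_inf [v * x] q" 1 "at 0" 0]
    by (simp add: isCont_def eventually_nhds_conv_at)
  then have "\<forall>\<^sub>F x in nhds 0. ?f x * qpoch_inf [v * x] q = qpoch_inf [u * x] q"
    by eventually_elim simp
  ultimately show "(\<lambda>x. qpoch_inf [u * x] q) has_fps_expansion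
      fps_expansion ?f 0 * qpoch_inf_fps q v"
    by (simp add: has_fps_expansion_cong)
qed

section \<open>The \<open>q\<close>-binomial theorem for formal power series\<close>

lemma one_minus_power_neq_0: "1 - q ^ Suc n \<noteq> 0"
proof
  assume "1 - q ^ Suc n = 0"
  then have "norm q ^ Suc n = 1"
    by (metis eq_iff_diff_eq_0 norm_one norm_power)
  then show False
    using q power_less_one_iff[of "norm q" "Suc n"] by simp
qed

lemma qpoch_q_neq_0: "qpoch [q] q n \<noteq> 0"
  using one_minus_power_neq_0 by (auto simp: qpoch_Cons mult.commute)

text \<open>This is the \<open>q\<close>-binomial theorem with the denominator multiplied out. Both
  sides solve \<open>P(x) = (1 - A x) P(q x)\<close> and have constant term 1; since
  \<open>1 - q ^ Suc n\<close> never vanishes, these two facts determine every coefficient.\<close>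

lemma q_binomial_fps:
  assumes "B \<noteq> 0"
  shows "Abs_fps (\<lambda>n. qpoch [A / B] q n / qpoch [q] q n * B ^ n) * qpoch_inf_fps q B =
    qpoch_inf_fps q A"
proof -
  define H where "H = Abs_fps (\<lambda>n. qpoch [A / B] q n / qpoch [q] q n * B ^ n)"
  define D where "D = H * qpoch_inf_fps q B"
  let ?qX = "fps_const q * fps_X"
  have H_Suc: "(1 - q ^ Suc n) * fps_nth H (Suc n) = (B - A * q ^ n) * fps_nth H n" for n
    using one_minus_power_neq_0[of n] assms qpoch_q_neq_0
    by (simp add: H_def qpoch_Cons field_simps)
  \<comment> \<open>The two-term recurrence for the coefficients, read as the functional equation
    \<open>(1 - B x) H(x) = (1 - A x) H(q x)\<close>.\<close>
  have "(1 - fps_const B * fps_X) * H = (1 - fps_const A * fps_X) * (H oo ?qX)"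
  proof (rule fps_ext)
    fix n
    show "fps_nth ((1 - fps_const B * fps_X) * H) n = fps_nth ((1 - fps_const A * fps_X) * (H oo ?qX)) n"
      using H_Suc[of "n - 1"]
      by (cases n; simp add: fps_compose_linear left_diff_distrib mult.assoc; simp add: algebra_simps)
  qed
  \<comment> \<open>The new factor is the infinite product for \<open>B\<close> evaluated at
    \<open>q x\<close>. On the left it absorbs \<open>1 - B x\<close>, so \<open>D\<close> satisfies
    an equation without \<open>B\<close>.\<close>
  then have "((1 - fps_const B * fps_X) * H) * qpoch_inf_fps q (q * B) =
      ((1 - fps_const A * fps_X) * (H oo ?qX)) * (qpoch_inf_fps q B oo ?qX)"
    by (simp add: qpoch_inf_fps_compose)
  then have "D = (1 - fps_const A * fps_X) * (D oo ?qX)"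
    using qpoch_inf_fps_rec[of B] fps_compose_mult_distrib[of ?qX H "qpoch_inf_fps q B"]
    by (simp add: D_def mult_ac)
  moreover have "qpoch_inf_fps q A = (1 - fps_const A * fps_X) * (qpoch_inf_fps q A oo ?qX)"
    by (subst qpoch_inf_fps_rec) (simp add: qpoch_inf_fps_compose)
  \<comment> \<open>Stated for an arbitrary solution \<open>P\<close>, so that it serves both
    \<open>D\<close> and \<open>qpoch_inf_fps q A\<close> in the induction.\<close>
  moreover have rec: "(1 - q ^ Suc n) * fps_nth P (Suc n) = - A * q ^ n * fps_nth P n"
    if P: "P = (1 - fps_const A * fps_X) * (P oo ?qX)" for P n
  proof -
    have "fps_nth P (Suc n) = fps_nth ((1 - fps_const A * fps_X) * (P oo ?qX)) (Suc n)"
      using P by simp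
    also have "\<dots> = q ^ Suc n * fps_nth P (Suc n) - A * (q ^ n * fps_nth P n)"
      by (simp add: fps_compose_linear left_diff_distrib mult.assoc)
    finally show ?thesis
      by (simp add: algebra_simps)
  qed
  ultimately have "fps_nth D n = fps_nth (qpoch_inf_fps q A) n" for n
  proof (induction n)
    case 0
    show ?case by (simp add: D_def H_def qpoch_def)
  next
    case (Suc n)
    then have "(1 - q ^ Suc n) * fps_nth D (Suc n) = (1 - q ^ Suc n) * fps_nth (qpoch_inf_fps q A) (Suc n)"
      by metis
    then show ?case using one_minus_power_neq_0[of n] by simp
  qed
  then show ?thesis by (simp add: fps_eq_iff D_def H_def)
qed

end

subsection \<open>Exchanging the summations\<close>

lemma qpoch_Cons2 [simp]: "qpoch (a # b # bs) q n = qpoch [a] q n * qpoch (b # bs) q n"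
  by (simp add: qpoch_Cons)

lemma qpoch_singleton: "qpoch [a] q n = (\<Prod>i<n. 1 - q ^ i * a)"
  by (simp add: qpoch_Cons)

lemma qpoch_add: "qpoch [a] q (n + k) = qpoch [a] q n * qpoch [q ^ n * a] q k"
  by (induction k) (simp_all add: qpoch_singleton power_add mult_ac)

lemma qpoch_inverse_power_eq_0:
  fixes q :: "'a::field"
  assumes "q \<noteq> 0" "n < k"
  shows "qpoch [1 / q ^ n] q k = 0"
  using assms by (auto simp: qpoch_singleton intro!: bexI[of _ n])

text \<open>With \<open>v = q / (q ^ (j + k) * u)\<close>, the numbers \<open>q ^ i * v\<close> and
  \<open>q ^ (k - 1 - i) * q ^ j * u\<close> are mutually inverse. Hence each factor
  \<open>1 - q ^ i * v\<close> is \<open>- (q ^ i) * v\<close> times a factor of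
  \<open>(q ^ j * u; q)_k\<close>, taken in reverse order.\<close>

lemma qpoch_reverse:
  fixes q :: "'a::field"
  assumes "q \<noteq> 0" "u \<noteq> 0"
  shows "qpoch [q / (q ^ (j + k) * u)] q k * qpoch [u] q j =
    (\<Prod>i<k. - (q ^ i)) * (q / (q ^ (j + k) * u)) ^ k * qpoch [u] q (j + k)"
proof -
  let ?v = "q / (q ^ (j + k) * u)"
  have "qpoch [q ^ j * u] q k = (\<Prod>i<k. 1 - q ^ (k - Suc i) * (q ^ j * u))"
    unfolding qpoch_singleton by (rule prod.nat_diff_reindex[symmetric])
  then have "(\<Prod>i<k. - (q ^ i)) * ?v ^ k * qpoch [q ^ j * u] q k =
      (\<Prod>i<k. - (q ^ i) * ?v * (1 - q ^ (k - Suc i) * (q ^ j * u)))"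
    by (simp only: prod.distrib) simp
  also have "\<dots> = (\<Prod>i<k. 1 - q ^ i * ?v)"
  proof (rule prod.cong)
    fix i assume "i \<in> {..<k}"
    then obtain l where "k = Suc (i + l)"
      using less_imp_Suc_add by auto
    then show "- (q ^ i) * ?v * (1 - q ^ (k - Suc i) * (q ^ j * u)) = 1 - q ^ i * ?v"
      using assms by (simp add: field_simps power_add)
  qed simp
  finally have "qpoch [?v] q k = (\<Prod>i<k. - (q ^ i)) * ?v ^ k * qpoch [q ^ j * u] q k"
    by (simp only: qpoch_singleton)
  then show ?thesis
    by (simp only: qpoch_add mult_ac)
qed

text \<open>The pair \<open>r, - r\<close> gives the even-indexed factors of the right-hand side and
  the pair \<open>w, - w\<close> the odd-indexed ones. This merges the last four lower parameters in
  \<open>Psi\<close>, and only the square of \<open>csqrt q\<close> survives.\<close>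

lemma qpoch_double:
  fixes q :: "'a::comm_ring_1"
  assumes "r ^ 2 = z" "w ^ 2 = q * z"
  shows "qpoch [r, - r, w, - w] q k = qpoch [z] q (2 * k)"
proof (induction k)
  case (Suc k)
  have "(1 - q ^ k * r) * (1 - q ^ k * - r) * (1 - q ^ k * w) * (1 - q ^ k * - w) =
      (1 - q ^ (2 * k) * z) * (1 - q ^ Suc (2 * k) * z)"
  proof -
    have "(1 - q ^ k * r) * (1 - q ^ k * - r) = 1 - q ^ (2 * k) * r ^ 2"
      "(1 - q ^ k * w) * (1 - q ^ k * - w) = 1 - q ^ (2 * k) * w ^ 2"
      by (simp_all add: algebra_simps power2_eq_square mult_2_right power_add)
    then have "((1 - q ^ k * r) * (1 - q ^ k * - r)) * ((1 - q ^ k * w) * (1 - q ^ k * - w)) =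
        (1 - q ^ (2 * k) * z) * (1 - q ^ Suc (2 * k) * z)"
      by (simp only: assms power_Suc mult_ac)
    then show ?thesis
      by (simp only: mult.assoc)
  qed
  moreover have "qpoch [r, - r, w, - w] q (Suc k) = qpoch [r, - r, w, - w] q k *
      ((1 - q ^ k * r) * (1 - q ^ k * - r) * (1 - q ^ k * w) * (1 - q ^ k * - w))"
    by (simp add: qpoch_singleton)
  moreover have "qpoch [z] q (2 * Suc k) =
      qpoch [z] q (2 * k) * ((1 - q ^ (2 * k) * z) * (1 - q ^ Suc (2 * k) * z))"
    by (simp add: qpoch_singleton)
  ultimately show ?case
    using Suc by simp
qed (simp add: qpoch_singleton)

text \<open>Beyond \<open>m\<close> the numerator vanishes, so each term is 0 whatever its
  denominator. The general type covers both complex numbers and Laurent series.\<close>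

lemma basic_hypergeo_terminating:
  fixes as bs :: "'a::{field,t2_space} list"
  assumes "a \<in> set as" "\<And>k. k > m \<Longrightarrow> qpoch [a] q k = 0"
  shows "basic_hypergeo as bs q z = (\<Sum>k\<le>m. qpoch as q k / qpoch (q # bs) q k * z ^ k)"
  unfolding basic_hypergeo_def
proof (rule suminf_finite)
  fix k assume "k \<notin> {..m}"
  then have "qpoch [a] q k = 0"
    using assms by simp
  with assms(1) have "qpoch as q k = 0"
    by (induction as) (auto simp: qpoch_Cons)
  then show "qpoch as q k / qpoch (q # bs) q k * z ^ k = 0"
    by simp
qed simp

text \<open>The inner series stops at an index \<open>m\<close> independent of \<open>n\<close>, so
  the two sums can be exchanged coefficientwise. For fixed \<open>k\<close> what remains is a
  \<open>q\<close>-binomial series with \<open>A = q ^ (k + 1) * s / a\<close> and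
  \<open>B = a / (q ^ k * s)\<close>. The parameters \<open>b'\<close>, \<open>c'\<close>,
  \<open>d'\<close> and \<open>e\<close> are merely carried along.\<close>

lemma Psi_series_eq:
  fixes q s a e b' c' d' :: complex
  assumes q: "norm q < 1" "q \<noteq> 0" and "s \<noteq> 0" "a \<noteq> 0"
    and s_term: "\<And>k. k > m \<Longrightarrow> qpoch [s] q k = 0"
    and nz: "\<And>k. k \<le> m \<Longrightarrow> qpoch [q * s ^ 2 / a ^ 2] q (2 * k) \<noteq> 0"
  shows "Abs_fps (\<lambda>n. qpoch [q * s^2 / a^2] q n / qpoch [q] q n * (a / s) ^ n *
       basic_hypergeo [q powi (- int n), q ^ (n + 1) * s^2 / a^2, s, b', c', d']
         [e, csqrt q * s / a, - (csqrt q * s / a), q * s / a, - (q * s / a)] q q) =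
    (\<Sum>k\<le>m. fps_const (qpoch [s, b', c', d'] q k / qpoch [q, e] q k * q ^ k *
        ((\<Prod>i<k. - (q ^ i)) / q ^ (k * k)) * (a / s) ^ k) * fps_X ^ k *
      Abs_fps (\<lambda>n. qpoch [(q ^ (k + 1) * s / a) / (a / (q ^ k * s))] q n / qpoch [q] q n *
        (a / (q ^ k * s)) ^ n))" (is "?lhs = ?rhs")
proof (rule fps_ext)
  fix n
  define Z where "Z = q * s^2 / a^2"
  have V: "qpoch [csqrt q * s / a, - (csqrt q * s / a), q * s / a, - (q * s / a)] q k =
      qpoch [Z] q (2 * k)" for k
    by (rule qpoch_double)
       (simp_all add: Z_def power_mult_distrib power_divide, simp add: power2_eq_square)
  have qn: "q powi (- int n) = 1 / q ^ n"
    by (simp add: power_int_minus divide_inverse)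
  have summand: "qpoch [Z] q n / qpoch [q] q n * (a / s) ^ n *
      (qpoch [q powi (- int n), q ^ (n + 1) * s^2 / a^2, s, b', c', d'] q k /
        qpoch (q # [e, csqrt q * s / a, - (csqrt q * s / a), q * s / a, - (q * s / a)]) q k * q ^ k) =
    fps_nth (fps_const (qpoch [s, b', c', d'] q k / qpoch [q, e] q k * q ^ k *
        ((\<Prod>i<k. - (q ^ i)) / q ^ (k * k)) * (a / s) ^ k) * fps_X ^ k *
      Abs_fps (\<lambda>n. qpoch [(q ^ (k + 1) * s / a) / (a / (q ^ k * s))] q n / qpoch [q] q n *
        (a / (q ^ k * s)) ^ n)) n" (is "?l = ?r")
    if "k \<le> m" for k
  \<comment> \<open>For \<open>n < k\<close> both sides are 0: on the left because of the parameter
    \<open>q\<close> to the power \<open>- n\<close>, on the right because of the factor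
    \<open>fps_X ^ k\<close>.\<close>
  proof (cases "n < k")
    case True
    then show ?thesis
      using qpoch_inverse_power_eq_0[OF q(2) True]
      by (simp add: qn fps_X_power_mult_nth mult.assoc)
  next
    case False
    then obtain j where n: "n = j + k"
      by (metis add.commute le_add_diff_inverse linorder_not_less)
    define M where "M = qpoch [s, b', c', d'] q k / qpoch [q, e] q k"
    define t where "t = (\<Prod>i<k. - (q ^ i))"
    have Z1: "q ^ (n + 1) * s^2 / a^2 = q ^ n * Z"
      by (simp add: Z_def)
    have Z2: "(q ^ (k + 1) * s / a) / (a / (q ^ k * s)) = q ^ (2 * k) * Z"
      using q \<open>s \<noteq> 0\<close> \<open>a \<noteq> 0\<close>
      by (simp add: Z_def field_simps power2_eq_square mult_2_right power_add)
    \<comment> \<open>Two ways of splitting \<open>(Z; q)_(n + k)\<close>, as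
      \<open>n + k = 2 * k + j\<close>.\<close>
    have Zn: "qpoch [Z] q n * qpoch [q ^ n * Z] q k = qpoch [Z] q (2 * k) * qpoch [q ^ (2 * k) * Z] q j"
      unfolding qpoch_add[symmetric] by (simp add: n mult_2 add_ac)
    have W: "qpoch [Z] q (2 * k) \<noteq> 0"
      using nz[OF that] by (simp add: Z_def)
    have N: "qpoch [1 / q ^ n] q k * qpoch [q] q j = t * (1 / q ^ n) ^ k * qpoch [q] q n"
      using qpoch_reverse[OF q(2) q(2), of j k] q by (simp add: n t_def)
    have nzq: "qpoch [q] q i \<noteq> 0" for i
      by (rule qpoch_q_neq_0[OF q(1)])
    \<comment> \<open>Since \<open>n * k = j * k + k * k\<close>, the power of \<open>q\<close>
      splits into a part depending on \<open>k\<close> only and a part that rescales the base of the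
      \<open>j\<close>-th power.\<close>
    have pw: "(a / s) ^ n * (1 / q ^ n) ^ k = (a / s) ^ k / q ^ (k * k) * (a / (q ^ k * s)) ^ j"
      by (simp add: n power_add power_divide power_mult_distrib flip: power_mult)
         (simp add: algebra_simps power_add)
    have "?l = (qpoch [Z] q n * qpoch [q ^ n * Z] q k) / qpoch [Z] q (2 * k) *
        (qpoch [1 / q ^ n] q k / qpoch [q] q n) * (a / s) ^ n * M * q ^ k"
      unfolding qn Z1 M_def qpoch_Cons2[of q] qpoch_Cons2[of e] V by (simp add: mult_ac)
    also have "\<dots> = qpoch [q ^ (2 * k) * Z] q j * (qpoch [1 / q ^ n] q k / qpoch [q] q n) *
        (a / s) ^ n * M * q ^ k"
      using W by (simp add: Zn)
    also have "qpoch [1 / q ^ n] q k / qpoch [q] q n = t * (1 / q ^ n) ^ k / qpoch [q] q j"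
      using N nzq by (simp add: divide_eq_eq eq_divide_eq)
    also have "qpoch [q ^ (2 * k) * Z] q j * (t * (1 / q ^ n) ^ k / qpoch [q] q j) *
        (a / s) ^ n * M * q ^ k = 
        M * q ^ k * t * qpoch [q ^ (2 * k) * Z] q j / qpoch [q] q j * ((a / s) ^ n * (1 / q ^ n) ^ k)"
      by simp
    also have "\<dots> = ?r"
      unfolding pw Z2 M_def[symmetric] t_def[symmetric]
      by (simp add: fps_X_power_mult_nth mult.assoc n) (simp add: mult_ac)
    finally show ?thesis .
  qed
  \<comment> \<open>Termination is drawn from the parameter \<open>s\<close> and not from
    \<open>q powi (- int n)\<close>, which makes the bound \<open>m\<close> uniform in
    \<open>n\<close>.\<close>
  have "basic_hypergeo [q powi (- int n), q ^ (n + 1) * s^2 / a^2, s, b', c', d']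
         [e, csqrt q * s / a, - (csqrt q * s / a), q * s / a, - (q * s / a)] q q =
      (\<Sum>k\<le>m. qpoch [q powi (- int n), q ^ (n + 1) * s^2 / a^2, s, b', c', d'] q k /
        qpoch (q # [e, csqrt q * s / a, - (csqrt q * s / a), q * s / a, - (q * s / a)]) q k * q ^ k)"
    by (rule basic_hypergeo_terminating[of s]) (use s_term in auto)
  then show "fps_nth ?lhs n = fps_nth ?rhs n"
    unfolding fps_sum_nth fps_nth_Abs_fps Z_def[symmetric]
    by (simp only: sum_distrib_left) (rule sum.cong, simp, rule summand, simp)
qed

subsection \<open>Reversing the finite sum\<close>

text \<open>For \<open>s = 1 / q ^ m\<close> and \<open>j = m - k\<close> the
  \<open>q\<close>-binomial parameters are \<open>B = q ^ j * a\<close> and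
  \<open>A = q / (q ^ j * a)\<close>. They differ from \<open>a\<close> and \<open>q / a\<close> by
  powers of \<open>q\<close>, so all but finitely many factors cancel.\<close>

lemma Psi_eq:
  fixes a b c d q :: complex and m :: nat
  assumes q: "norm q < 1" "q \<noteq> 0" and a: "a \<noteq> 0"
    and nz: "\<And>k. q ^ k * a ^ 2 \<noteq> 1"
  defines "s \<equiv> 1 / q ^ m"
  shows "Psi s a b c d q = (\<Sum>k\<le>m.
      fps_const (qpoch [s, q * s / (a * b), q * s / (a * c), q * s / (a * d)] q k /
          qpoch [q, q^2 * s^2 / (a * b * c * d)] q k * q ^ k *
          ((\<Prod>i<k. - (q ^ i)) / q ^ (k * k)) * (a / s) ^ k) * fps_X ^ k *
      (\<Prod>i<m - k. (1 - fps_const (q ^ i * a) * fps_X) * (1 - fps_const (1 / (q ^ i * a)) * fps_X)))"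
proof -
  have s: "s \<noteq> 0"
    using q by (simp add: s_def)
  let ?F = "fps_expansion (\<lambda>x. qpoch_inf [a * x] q / qpoch_inf [q * x / a] q) 0"
  let ?H = "\<lambda>k. Abs_fps (\<lambda>n. qpoch [(q ^ (k + 1) * s / a) / (a / (q ^ k * s))] q n / qpoch [q] q n *
        (a / (q ^ k * s)) ^ n)"
  have F: "?F * qpoch_inf_fps q (q / a) = qpoch_inf_fps q a"
    using fps_expansion_qpoch_inf_quotient[OF q(1), of a "q / a"] by simp
  have FH: "?F * ?H k = (\<Prod>i<m - k. (1 - fps_const (q ^ i * a) * fps_X) *
      (1 - fps_const (1 / (q ^ i * a)) * fps_X))" if "k \<le> m" for k
  proof -
    obtain j where m: "m = j + k"
      using \<open>k \<le> m\<close> by (metis le_add_diff_inverse2)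
    let ?A = "q ^ (k + 1) * s / a" and ?B = "a / (q ^ k * s)"
    have B: "?B = q ^ j * a" and A: "q ^ j * ?A = q / a"
      using q by (simp_all add: s_def m power_add field_simps)
    \<comment> \<open>Reversing the product turns the exponents, which run from \<open>1 - j\<close>
      up to 0, into \<open>- i\<close>.\<close>
    have "(\<Prod>i<j. 1 - fps_const (q ^ i * ?A) * fps_X) =
        (\<Prod>i<j. 1 - fps_const (q ^ (j - Suc i) * ?A) * fps_X)"
      by (rule prod.nat_diff_reindex[symmetric])
    also have "\<dots> = (\<Prod>i<j. 1 - fps_const (1 / (q ^ i * a)) * fps_X)"
    proof (rule prod.cong)
      fix i assume "i \<in> {..<j}"
      then obtain l where "j = Suc (i + l)"
        using less_imp_Suc_add by auto
      then show "1 - fps_const (q ^ (j - Suc i) * ?A) * fps_X =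
          1 - fps_const (1 / (q ^ i * a)) * fps_X"
        using q a by (simp add: s_def m power_add field_simps)
    qed simp
    finally have EA: "qpoch_inf_fps q ?A =
        (\<Prod>i<j. 1 - fps_const (1 / (q ^ i * a)) * fps_X) * qpoch_inf_fps q (q / a)"
      using qpoch_inf_fps_split[OF q(1), of ?A j] by (simp only: A)
    have "?B \<noteq> 0"
      using q a s by simp
    from q_binomial_fps[OF q(1) this, of ?A]
    have H: "?H k * qpoch_inf_fps q (q ^ j * a) = qpoch_inf_fps q ?A"
      unfolding B .
    have Ea: "qpoch_inf_fps q a =
        (\<Prod>i<j. 1 - fps_const (q ^ i * a) * fps_X) * qpoch_inf_fps q (q ^ j * a)"
      by (rule qpoch_inf_fps_split[OF q(1)])
    have cancel: "F * H = p * p'" if "F * e = p * e'" "H * e' = p' * e" "e \<noteq> 0" "e' \<noteq> 0"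
      for F H p p' e e' :: "complex fps"
    proof -
      have "(F * H) * (e * e') = (F * e) * (H * e')"
        by (simp only: mult_ac)
      also have "\<dots> = (p * p') * (e * e')"
        by (simp only: that mult_ac)
      finally show ?thesis
        using that by simp
    qed
    have "qpoch_inf_fps q v \<noteq> 0" for v
      using qpoch_inf_fps_nth_0[OF q(1), of v] by force
    from cancel[OF F[unfolded Ea] H[unfolded EA] this this] show ?thesis
      unfolding m add_diff_cancel_right' prod.distrib .
  qed
  have nz_Z: "qpoch [q * s ^ 2 / a ^ 2] q (2 * k) \<noteq> 0" if "k \<le> m" for k
  proof -
    have "1 - q ^ i * (q * s ^ 2 / a ^ 2) \<noteq> 0" if "i < 2 * k" for i
    proof -
      \<comment> \<open>With this \<open>l\<close> the factor is
        \<open>1 - 1 / (q ^ l * a ^ 2)\<close>, which is nonzero by the condition on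
        \<open>a ^ 2\<close>.\<close>
      obtain l where "2 * m = Suc (i + l)"
        using \<open>i < 2 * k\<close> \<open>k \<le> m\<close> less_imp_Suc_add[of i "2 * m"] by auto
      then have "(q ^ m) ^ 2 = q ^ i * q * q ^ l"
        by (simp flip: power_mult power_add add: mult.commute)
      then have "q ^ i * (q * s ^ 2 / a ^ 2) * (q ^ l * a ^ 2) = 1"
        using q a by (simp add: s_def power_divide field_simps)
      then show ?thesis
        by (metis eq_iff_diff_eq_0 mult_1 nz)
    qed
    then show ?thesis
      by (auto simp: qpoch_singleton simp del: right_minus_eq)
  qed
  have s_term: "qpoch [s] q k = 0" if "k > m" for k
    using qpoch_inverse_power_eq_0[OF q(2) that] by (simp add: s_def)
  have "Psi s a b c d q = ?F * (\<Sum>k\<le>m. fps_const (qpoch [s, q * s / (a * b), q * s / (a * c), q * s / (a * d)] q k /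
          qpoch [q, q^2 * s^2 / (a * b * c * d)] q k * q ^ k *
          ((\<Prod>i<k. - (q ^ i)) / q ^ (k * k)) * (a / s) ^ k) * fps_X ^ k * ?H k)"
    by (simp only: Psi_def Psi_series_eq[OF q s a s_term nz_Z])
  also have "\<dots> = (\<Sum>k\<le>m. fps_const (qpoch [s, q * s / (a * b), q * s / (a * c), q * s / (a * d)] q k /
          qpoch [q, q^2 * s^2 / (a * b * c * d)] q k * q ^ k *
          ((\<Prod>i<k. - (q ^ i)) / q ^ (k * k)) * (a / s) ^ k) * fps_X ^ k * (?F * ?H k))"
    by (subst sum_distrib_left) (rule sum.cong[OF refl], rule mult.left_commute)
  finally show ?thesis
    using FH by simp
qed

text \<open>The product is \<open>(-1)^k q^(k (k - 1) / 2)\<close>; squaring removes the sign and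
  the halved exponent.\<close>

lemma prod_minus_power_squared:
  "(\<Prod>i<k. - (q ^ i)) ^ 2 * q ^ k = (q ^ (k * k) :: 'a::comm_ring_1)"
proof (induction k)
  case (Suc k)
  have "(\<Prod>i<Suc k. - (q ^ i)) ^ 2 * q ^ Suc k =
      ((\<Prod>i<k. - (q ^ i)) ^ 2 * q ^ k) * (q ^ k * q ^ k * q)"
    by (simp add: algebra_simps power2_eq_square)
  also have "\<dots> = q ^ (Suc k * Suc k)"
    by (subst Suc) (simp add: power_add algebra_simps)
  finally show ?case .
qed simp

text \<open>Matches the \<open>j\<close>-th coefficient on the left with the \<open>k\<close>-th on
  the right for \<open>j + k = m\<close>. Reversing every factorial of length \<open>k\<close> by
  \<open>qpoch_reverse\<close> leaves the same factorials on both sides, and the remaining powers of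
  \<open>q\<close> and \<open>a\<close> are compared separately. The last product is the scalar from
  \<open>qpoch_fls_X\<close>.\<close>

lemma hypergeo_coefficient_reverse:
  fixes a b c d q :: complex and m :: nat
  assumes q: "norm q < 1" "q \<noteq> 0" and nz: "a \<noteq> 0" "b \<noteq> 0" "c \<noteq> 0" "d \<noteq> 0"
    and m: "m = j + k"
    and poch: "\<And>n. qpoch [a * b] q n \<noteq> 0" "\<And>n. qpoch [a * c] q n \<noteq> 0"
      "\<And>n. qpoch [a * d] q n \<noteq> 0"
    and U: "U = a * b * c * d * q ^ m / q" "qpoch [U] q m \<noteq> 0"
  defines "s \<equiv> 1 / q ^ m"
  shows "qpoch [s, U] q j / qpoch [q, a * b, a * c, a * d] q j * q ^ j =
    a ^ m * (qpoch [U] q m / qpoch [a * b, a * c, a * d] q m) *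
    (qpoch [s, q * s / (a * b), q * s / (a * c), q * s / (a * d)] q k /
      qpoch [q, q^2 * s^2 / (a * b * c * d)] q k * q ^ k *
      ((\<Prod>i<k. - (q ^ i)) / q ^ (k * k)) * (a / s) ^ k) * (\<Prod>i<j. - 1 / (q ^ i * a))"
proof -
  define t where "t = (\<lambda>k. \<Prod>i<k. - (q ^ i))"
  have tk: "(\<Prod>i<k. - (q ^ i)) = t k" for k
    by (simp add: t_def)
  have t_nz: "t n \<noteq> 0" for n
    using q by (simp add: t_def)
  have t2: "t n ^ 2 * q ^ n = q ^ (n * n)" for n
    unfolding t_def by (rule prod_minus_power_squared)
  have nzq: "qpoch [q] q n \<noteq> 0" for n
    by (rule qpoch_q_neq_0[OF q(1)])
  have U_nz: "U \<noteq> 0"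
    using q nz by (simp add: U)
  define x where "x = (\<lambda>u. (q * s / u) ^ k)"
  have rev: "qpoch [q * s / u] q k = t k * x u * qpoch [u] q m / qpoch [u] q j"
    if "u \<noteq> 0" "qpoch [u] q j \<noteq> 0" for u
    using qpoch_reverse[OF q(2) that(1), of j k] that(2)
    by (simp add: x_def s_def m t_def eq_divide_eq)
  have Uj: "qpoch [U] q j \<noteq> 0"
    using U(2) by (simp add: m qpoch_add)
  \<comment> \<open>So the lower parameter of the series in \<open>Psi\<close> is the reversal of
    \<open>U\<close>.\<close>
  have e: "q^2 * s^2 / (a * b * c * d) = q * s / U"
    using q by (simp add: s_def U power2_eq_square)
  have sk: "qpoch [s] q k = t k * s ^ k * qpoch [q] q m / qpoch [q] q j"
    using rev[of q] q nzq by (simp add: x_def)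
  have sj: "qpoch [s] q j = t j * s ^ j * qpoch [q] q m / qpoch [q] q k"
    using qpoch_reverse[OF q(2) q(2), of k j] q nzq
    by (simp add: s_def m t_def eq_divide_eq add.commute)
  have pr: "(\<Prod>i<j. - 1 / (q ^ i * a)) = 1 / (t j * a ^ j)"
  proof -
    have "(\<Prod>i<j. - 1 / (q ^ i * a)) = (\<Prod>i<j. 1 / (- (q ^ i) * a))"
      by simp
    then show ?thesis
      by (simp only: t_def prod_dividef prod.distrib) simp
  qed
  \<comment> \<open>The factorials common to both sides; the rest consists of powers only.\<close>
  define C where "C = qpoch [q] q m * qpoch [U] q j /
    (qpoch [q] q j * qpoch [q] q k * qpoch [a * b] q j * qpoch [a * c] q j * qpoch [a * d] q j)"
  have lhs: "qpoch [s, U] q j / qpoch [q, a * b, a * c, a * d] q j * q ^ j = C * (t j * s ^ j * q ^ j)"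
    by (simp add: sj C_def mult_ac)
  have rhs: "a ^ m * (qpoch [U] q m / qpoch [a * b, a * c, a * d] q m) *
    (qpoch [s, q * s / (a * b), q * s / (a * c), q * s / (a * d)] q k /
      qpoch [q, q^2 * s^2 / (a * b * c * d)] q k * q ^ k *
      ((\<Prod>i<k. - (q ^ i)) / q ^ (k * k)) * (a / s) ^ k) * (\<Prod>i<j. - 1 / (q ^ i * a)) =
    C * (a ^ m * (t k ^ 4 * s ^ k * x (a * b) * x (a * c) * x (a * d)
      / (t k * x U) * q ^ k * (t k / q ^ (k * k)) * (a / s) ^ k) / (t j * a ^ j))"
  proof -
    have "x U \<noteq> 0"
      using q U_nz by (simp add: x_def s_def)
    moreover have "qpoch [q * s / (a * b)] q k = t k * x (a * b) * qpoch [a * b] q m / qpoch [a * b] q j"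
      "qpoch [q * s / (a * c)] q k = t k * x (a * c) * qpoch [a * c] q m / qpoch [a * c] q j"
      "qpoch [q * s / (a * d)] q k = t k * x (a * d) * qpoch [a * d] q m / qpoch [a * d] q j"
      "qpoch [q * s / U] q k = t k * x U * qpoch [U] q m / qpoch [U] q j"
      using nz poch U_nz Uj by (auto intro!: rev)
    ultimately show ?thesis
      unfolding e pr tk using poch nzq U(2) Uj t_nz
      by (simp add: sk C_def eval_nat_numeral)
         (simp add: mult_ac)
  qed
  \<comment> \<open>All quantities raised to the power \<open>k\<close> collapse to this single
    base.\<close>
  have base: "s * (q * s / (a * b)) * (q * s / (a * c)) * (q * s / (a * d)) * (a / s) / (q * s / U) =
      q * s / a"
    using q nz by (simp add: U s_def field_simps)
  define w y where "w = (a / s) ^ k" and "y = (q * s / a) ^ k"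
  have y: "s ^ k * x (a * b) * x (a * c) * x (a * d) * w / x U = y"
    unfolding y_def w_def x_def base[symmetric] by (simp only: power_mult_distrib power_divide)
  have "t k ^ 4 * s ^ k * x (a * b) * x (a * c) * x (a * d) / (t k * x U) * q ^ k *
      (t k / q ^ (k * k)) * w =
      t k ^ 4 * q ^ k * (s ^ k * x (a * b) * x (a * c) * x (a * d) * w / x U) / q ^ (k * k)"
    using t_nz[of k] by simp
  then have "a ^ m * (t k ^ 4 * s ^ k * x (a * b) * x (a * c) * x (a * d) / (t k * x U) * q ^ k *
      (t k / q ^ (k * k)) * w) / (t j * a ^ j) =
      a ^ m * (t k ^ 4 * q ^ k * (q * s / a) ^ k / q ^ (k * k)) / (t j * a ^ j)"
    by (simp only: y) (simp only: y_def)
  also have "\<dots> = (t k ^ 2 * q ^ k) ^ 2 * s ^ k / q ^ (k * k) / t j"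
    using nz q t_nz
    by (simp add: m power_add power_mult_distrib power_divide field_simps
        flip: power_mult)
       (simp add: power_mult power2_eq_square)
  also have "\<dots> = q ^ (k * k) * s ^ k / t j"
    unfolding t2 using q by (simp add: power2_eq_square)
  \<comment> \<open>With \<open>s = 1 / q ^ (j + k)\<close> both sides equal
    \<open>1 / q ^ (j * k)\<close>, which is symmetric in \<open>j\<close> and
    \<open>k\<close>.\<close>
  also have "q ^ (k * k) * s ^ k = q ^ (j * j) * s ^ j"
    using q by (simp add: s_def m power_divide field_simps flip: power_mult power_add)
  also have "q ^ (j * j) * s ^ j / t j = t j * s ^ j * q ^ j"
    unfolding t2[symmetric] using t_nz[of j] by (simp add: power2_eq_square)
  finally show ?thesis
    unfolding lhs rhs w_def by simp
qed

subsection \<open>Passage to Laurent series\<close>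

lemma fls_const_prod: "fls_const (prod f A) = (\<Prod>i\<in>A. fls_const (f i :: 'a::comm_ring_1))"
  by (induction A rule: infinite_finite_induct) (simp_all flip: fls_const_mult_const)

lemma qpoch_fls_const: "qpoch (map fls_const as) (fls_const q) n = fls_const (qpoch as q n)"
proof -
  have "fls_const (1 - q ^ i * a) = 1 - fls_const q ^ i * fls_const a" for i and a :: 'a
    by (simp flip: fls_minus_const fls_const_mult_const add: fls_const_power)
  then show ?thesis
    by (induction as) (simp_all add: qpoch_Cons fls_const_prod flip: fls_const_mult_const)
qed

lemma fps_to_fls_sum: "fps_to_fls (sum f A) = (\<Sum>i\<in>A. fps_to_fls (f i))"
  by (induction A rule: infinite_finite_induct) simp_all

lemma fps_to_fls_prod:
  "fps_to_fls (prod f A) = (\<Prod>i\<in>A. fps_to_fls (f i :: 'a::comm_ring_1 fps))"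
  by (induction A rule: infinite_finite_induct) (simp_all add: fls_times_fps_to_fls)

text \<open>Factor by factor, with \<open>u = q ^ i * a\<close>: multiplying
  \<open>1 - u / x\<close> by \<open>- x / u\<close> gives \<open>1 - x / u\<close>. This clears the
  negative powers of \<open>x\<close>.\<close>

lemma qpoch_fls_X:
  fixes a q :: "'a::field"
  assumes "a \<noteq> 0" "q \<noteq> 0"
  shows "fls_const (\<Prod>i<j. - 1 / (q ^ i * a)) * fls_X ^ j *
      qpoch [fls_const a * fls_X, fls_const a / fls_X] (fls_const q) j =
    fps_to_fls (\<Prod>i<j. (1 - fps_const (q ^ i * a) * fps_X) *
      (1 - fps_const (1 / (q ^ i * a)) * fps_X))"
proof -
  have "fls_const (- 1 / (q ^ i * a)) * fls_X * ((1 - fls_const q ^ i * (fls_const a * fls_X)) *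
      (1 - fls_const q ^ i * (fls_const a / fls_X))) =
    (1 - fls_const (q ^ i * a) * fls_X) * (1 - fls_const (1 / (q ^ i * a)) * fls_X)" for i
  proof -
    define u where "u = q ^ i * a"
    have "u \<noteq> 0"
      using assms by (simp add: u_def)
    then have "fls_const u \<noteq> 0"
      by simp
    moreover have "- (1 / U) * x * ((1 - U * x) * (1 - U / x)) = (1 - U * x) * (1 - 1 / U * x)"
      if "U \<noteq> 0" "x \<noteq> 0" for U x :: "'a fls"
      using that by (simp add: divide_simps) (simp add: algebra_simps)
    ultimately have "- (1 / fls_const u) * fls_X * ((1 - fls_const u * fls_X) * (1 - fls_const u / fls_X)) =
        (1 - fls_const u * fls_X) * (1 - 1 / fls_const u * fls_X)"
      by (simp only: fls_X_nonzero not_False_eq_True)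
    moreover have "fls_const (- 1 / u) = - (1 / fls_const u)" "fls_const (1 / u) = 1 / fls_const u"
      by (simp_all flip: fls_const_divide_const)
    moreover have "fls_const q ^ i * (fls_const a * y) = fls_const u * y"
      "fls_const q ^ i * (fls_const a / y) = fls_const u / y" for y
      by (simp_all add: u_def flip: fls_const_power fls_const_mult_const)
    ultimately show ?thesis
      by (simp only: u_def[symmetric])
  qed
  then have "(\<Prod>i<j. fls_const (- 1 / (q ^ i * a)) * fls_X * ((1 - fls_const q ^ i * (fls_const a * fls_X)) *
      (1 - fls_const q ^ i * (fls_const a / fls_X)))) =
    (\<Prod>i<j. (1 - fls_const (q ^ i * a) * fls_X) * (1 - fls_const (1 / (q ^ i * a)) * fls_X))"
    by (simp only:)
  then show ?thesis
    by (simp only: fps_to_fls_prod fls_times_fps_to_fls fls_const_prod prod.distrib prod_constant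
        card_lessThan qpoch_Cons2 qpoch_singleton fps_to_fls_minus fps_one_to_fls fps_const_to_fls
        fps_X_to_fls)
qed

theorem theorem2p2:
  fixes a b c d q :: complex and m :: nat
  assumes "norm q < 1" and "generic_params a b c d q"
  shows "basic_hypergeo
           [fls_const (q powi (- int m)), fls_const (a * b * c * d * q powi (int m - 1)),
            fls_const a * fls_X, fls_const a / fls_X]
           [fls_const (a * b), fls_const (a * c), fls_const (a * d)]
           (fls_const q) (fls_const q)
       = fls_const (a ^ m) * fls_X powi (- int m) *
         fls_const (qpoch [a * b * c * d * q powi (int m - 1)] q m /
                    qpoch [a * b, a * c, a * d] q m) *
         fps_to_fls (Psi (q powi (- int m)) a b c d q)"
proof -
  note q = assms(1)
  have nz: "a \<noteq> 0" "b \<noteq> 0" "c \<noteq> 0" "d \<noteq> 0" "q \<noteq> 0"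
    and gen: "\<And>k. q ^ k * (a * b) \<noteq> 1" "\<And>k. q ^ k * (a * c) \<noteq> 1" "\<And>k. q ^ k * (a * d) \<noteq> 1"
      "\<And>k. q ^ k * (a * b * c * d) \<noteq> 1" "\<And>k. q ^ k * a^2 \<noteq> 1"
    using assms(2) by (auto simp: generic_params_def)
  define s U where "s = 1 / q ^ m" and "U = a * b * c * d * q ^ m / q"
  have s: "q powi (- int m) = s"
    by (simp add: s_def power_int_minus divide_inverse)
  have U: "a * b * c * d * q powi (int m - 1) = U"
    using nz by (simp add: U_def power_int_diff)
  have poch: "qpoch [a * b] q n \<noteq> 0" "qpoch [a * c] q n \<noteq> 0" "qpoch [a * d] q n \<noteq> 0" for n
    using gen(1-3) by (auto simp: qpoch_singleton)
  \<comment> \<open>Here \<open>q ^ i * U\<close> is \<open>q ^ (i + (m - 1))\<close> times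
    \<open>a * b * c * d\<close>; \<open>i < m\<close> rules out \<open>m = 0\<close>, where the
    truncated subtraction would be wrong.\<close>
  have "1 - q ^ i * U \<noteq> 0" if "i < m" for i
    using gen(4)[of "i + (m - 1)"] that nz
    by (cases m) (auto simp: U_def power_add mult_ac)
  then have U_poch: "qpoch [U] q m \<noteq> 0"
    by (simp add: qpoch_singleton)
  define P where "P = (\<lambda>j. \<Prod>i<j. (1 - fps_const (q ^ i * a) * fps_X) *
      (1 - fps_const (1 / (q ^ i * a)) * fps_X))"
  define L where "L = (\<lambda>j. qpoch [s, U] q j / qpoch [q, a * b, a * c, a * d] q j * q ^ j)"
  define R where "R = (\<lambda>k. qpoch [s, q * s / (a * b), q * s / (a * c), q * s / (a * d)] q k /
          qpoch [q, q^2 * s^2 / (a * b * c * d)] q k * q ^ k *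
          ((\<Prod>i<k. - (q ^ i)) / q ^ (k * k)) * (a / s) ^ k)"
  define K where "K = a ^ m * (qpoch [U] q m / qpoch [a * b, a * c, a * d] q m)"
  let ?X = "qpoch [fls_const a * fls_X, fls_const a / fls_X] (fls_const q)"
  \<comment> \<open>The term-by-term match: \<open>L\<close> and \<open>R\<close> hold the scalar
    coefficients of the two sides, \<open>K\<close> the common prefactor.\<close>
  have summand: "fls_const (L j) * ?X j =
      fls_const K * fls_X powi (- int m) * fps_to_fls (fps_const (R k) * fps_X ^ k * P j)"
    if m: "m = j + k" for j k
  proof -
    have "L j = K * R k * (\<Prod>i<j. - 1 / (q ^ i * a))"
      unfolding L_def K_def R_def s_def
      using hypergeo_coefficient_reverse[OF q nz(5) nz(1-4) m poch U_def U_poch] by simp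
    moreover have "x powi (- int m) * x ^ k * x ^ j = 1" if "x \<noteq> 0" for x :: "complex fls"
    proof -
      have "x powi (- int m) = 1 / x ^ m"
        by (simp add: power_int_minus divide_inverse)
      then show ?thesis
        using that by (simp add: m power_add)
    qed
    from this[OF fls_X_nonzero]
    have "fls_X powi (- int m) * fls_X ^ k * fls_X ^ j = (1 :: complex fls)" .
    ultimately have "fls_const (L j) * ?X j = fls_const K * fls_X powi (- int m) *
        (fls_const (R k) * fls_X ^ k *
          (fls_const (\<Prod>i<j. - 1 / (q ^ i * a)) * fls_X ^ j * ?X j))"
      by (simp add: mult_ac flip: fls_const_mult_const)
    also have "\<dots> = fls_const K * fls_X powi (- int m) * fps_to_fls (fps_const (R k) * fps_X ^ k * P j)"
      unfolding qpoch_fls_X[OF nz(1,5)] P_def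
      by (simp add: fls_times_fps_to_fls fps_to_fls_power)
    finally show ?thesis .
  qed
  have s_term: "qpoch [fls_const s] (fls_const q) k = 0" if "k > m" for k
    using qpoch_fls_const[of "[s]" q k] qpoch_inverse_power_eq_0[OF nz(5) that] by (simp add: s_def)
  have "basic_hypergeo [fls_const s, fls_const U, fls_const a * fls_X, fls_const a / fls_X]
           [fls_const (a * b), fls_const (a * c), fls_const (a * d)] (fls_const q) (fls_const q) =
      (\<Sum>j\<le>m. fls_const (L j) * ?X j)"
  proof (subst basic_hypergeo_terminating[of "fls_const s" _ m])
    have "qpoch [fls_const s, fls_const U, fls_const a * fls_X, fls_const a / fls_X] (fls_const q) j /
        qpoch [fls_const q, fls_const (a * b), fls_const (a * c), fls_const (a * d)] (fls_const q) j *
        fls_const q ^ j = fls_const (L j) * ?X j" for j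
      using qpoch_fls_const[of "[s, U]" q j] qpoch_fls_const[of "[q, a * b, a * c, a * d]" q j]
      by (simp add: L_def mult_ac
          flip: fls_const_power fls_const_divide_const fls_const_mult_const)
    then show "(\<Sum>k\<le>m. qpoch [fls_const s, fls_const U, fls_const a * fls_X, fls_const a / fls_X] (fls_const q) k /
        qpoch [fls_const q, fls_const (a * b), fls_const (a * c), fls_const (a * d)] (fls_const q) k *
        fls_const q ^ k) = (\<Sum>j\<le>m. fls_const (L j) * ?X j)"
      by (simp only:)
  qed (use s_term in auto)
  \<comment> \<open>The reindexing rule is for sums over \<open>{..<n}\<close>; taking
    \<open>n = Suc m\<close> gives the closed range.\<close>
  also have "\<dots> = (\<Sum>k\<le>m. fls_const (L (m - k)) * ?X (m - k))"
    by (rule sum.nat_diff_reindex[where n = "Suc m", symmetric, unfolded lessThan_Suc_atMost diff_Suc_Suc])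
  also have "\<dots> = (\<Sum>k\<le>m. fls_const K * fls_X powi (- int m) *
      fps_to_fls (fps_const (R k) * fps_X ^ k * P (m - k)))"
    by (rule sum.cong[OF refl], rule summand) simp
  also have "\<dots> = fls_const K * fls_X powi (- int m) * fps_to_fls (Psi s a b c d q)"
    unfolding s_def Psi_eq[OF q nz(5,1) gen(5), of m b c d]
    unfolding fps_to_fls_sum sum_distrib_left
    by (simp only: R_def P_def s_def)
  finally show ?thesis
    unfolding s U K_def by (simp only: mult_ac flip: fls_const_mult_const)
qed

end
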